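(* Let $(A_1,A_2)$ be a solution of the ODE system $iA_1'=F_1(A_1,A_2)$, $iA_2'=F_2(A_1,A_2)$ (with $F_1,F_2$ as in the context), and let $\rho:=|A_1|^2+|A_2|^2$, $\mathcal{D}:=|A_1|^2-|A_2|^2$, $\mathcal{R}:=2\operatorname{Re}(\overline{A_1}A_2)$, $\mathcal{I}:=2\operatorname{Im}(\overline{A_1}A_2)$. Then $(\mathcal{D},\mathcal{R},\mathcal{I})$ solves $$\begin{bmatrix}\mathcal{D}\\\mathcal{R}\end{bmatrix}'=2\mathcal{I}\begin{bmatrix}p_1&p_2-p_3\\-p_2-p_3&p_1\end{bmatrix}\begin{bmatrix}\mathcal{D}\\\mathcal{R}\end{bmatrix}+2\rho\,\mathcal{I}\begin{bmatrix}p_5\\-p_4\end{bmatrix},$$ $$\mathcal{I}'=-2p_1(\mathcal{D}^2+\mathcal{R}^2)+4p_3\mathcal{D}\mathcal{R}+2\rho(-p_5\mathcal{D}+p_4\mathcal{R}).$$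
   Context: Parameters: $p_1\ge0$, $p_2\in\mathbb{R}$, $p_3\ge0$, $p_4\in\mathbb{R}$, $p_5\ge0$, not all zero; $q_1,q_2,q_3\in\mathbb{R}$. The nonlinearities are $$F_1(u_1,u_2)=(3p_2+p_3+2p_4)|u_1|^2u_1+(p_1+p_5)(2|u_1|^2u_2+u_1^2\overline{u_2})+(p_2-p_3)(2u_1|u_2|^2+\overline{u_1}u_2^2)-(p_1-p_5)|u_2|^2u_2-4p_1\operatorname{Re}(\overline{u_1}u_2)u_1+\mathcal{V}(u_1,u_2)u_1,$$ $$F_2(u_1,u_2)=(p_1+p_5)|u_1|^2u_1+(p_2-p_3)(2|u_1|^2u_2+u_1^2\overline{u_2})-(p_1-p_5)(2u_1|u_2|^2+\overline{u_1}u_2^2)+(3p_2+p_3-2p_4)|u_2|^2u_2+4p_1\operatorname{Re}(\overline{u_1}u_2)u_2+\mathcal{V}(u_1,u_2)u_2,$$ with $\mathcal{V}(u_1,u_2)=q_1|u_1|^2+2q_2\operatorname{Re}(\overline{u_1}u_2)+q_3|u_2|^2$. The quantity $\rho$ is conserved (constant in time) along solutions. *)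

theory Defs
  imports "HOL-Analysis.Analysis"
begin

definition pot :: "real \<Rightarrow> real \<Rightarrow> real \<Rightarrow> complex \<Rightarrow> complex \<Rightarrow> real" where
  "pot q1 q2 q3 u1 u2 = q1 * (cmod u1)\<^sup>2 + 2 * q2 * Re (cnj u1 * u2) + q3 * (cmod u2)\<^sup>2"

definition F1 ::
  "real \<Rightarrow> real \<Rightarrow> real \<Rightarrow> real \<Rightarrow> real \<Rightarrow> real \<Rightarrow> real \<Rightarrow> real \<Rightarrow> complex \<Rightarrow> complex \<Rightarrow> complex" where
  "F1 p1 p2 p3 p4 p5 q1 q2 q3 u1 u2 =
     of_real (3 * p2 + p3 + 2 * p4) * of_real ((cmod u1)\<^sup>2) * u1
     + of_real (p1 + p5) * (2 * of_real ((cmod u1)\<^sup>2) * u2 + u1\<^sup>2 * cnj u2)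
     + of_real (p2 - p3) * (2 * u1 * of_real ((cmod u2)\<^sup>2) + cnj u1 * u2\<^sup>2)
     - of_real (p1 - p5) * of_real ((cmod u2)\<^sup>2) * u2
     - of_real (4 * p1 * Re (cnj u1 * u2)) * u1
     + of_real (pot q1 q2 q3 u1 u2) * u1"

definition F2 ::
  "real \<Rightarrow> real \<Rightarrow> real \<Rightarrow> real \<Rightarrow> real \<Rightarrow> real \<Rightarrow> real \<Rightarrow> real \<Rightarrow> complex \<Rightarrow> complex \<Rightarrow> complex" where
  "F2 p1 p2 p3 p4 p5 q1 q2 q3 u1 u2 =
     of_real (p1 + p5) * of_real ((cmod u1)\<^sup>2) * u1
     + of_real (p2 - p3) * (2 * of_real ((cmod u1)\<^sup>2) * u2 + u1\<^sup>2 * cnj u2)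
     - of_real (p1 - p5) * (2 * u1 * of_real ((cmod u2)\<^sup>2) + cnj u1 * u2\<^sup>2)
     + of_real (3 * p2 + p3 - 2 * p4) * of_real ((cmod u2)\<^sup>2) * u2
     + of_real (4 * p1 * Re (cnj u1 * u2)) * u2
     + of_real (pot q1 q2 q3 u1 u2) * u2"

text \<open>
  A classical solution on a time interval \<open>T\<close> of any kind (open or not, bounded or not);
  derivatives are taken within \<open>T\<close>, so they are one-sided at endpoints belonging to \<open>T\<close>.
\<close>

definition solves_system ::
  "(complex \<Rightarrow> complex \<Rightarrow> complex) \<Rightarrow> (complex \<Rightarrow> complex \<Rightarrow> complex) \<Rightarrow> real set
    \<Rightarrow> (real \<Rightarrow> complex) \<Rightarrow> (real \<Rightarrow> complex) \<Rightarrow> bool" where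
  "solves_system G1 G2 T A1 A2 \<longleftrightarrow>
     is_interval T \<and>
     (\<forall>t\<in>T. \<exists>d1 d2.
        (A1 has_vector_derivative d1) (at t within T) \<and>
        (A2 has_vector_derivative d2) (at t within T) \<and>
        \<i> * d1 = G1 (A1 t) (A2 t) \<and>
        \<i> * d2 = G2 (A1 t) (A2 t))"

definition rho :: "(real \<Rightarrow> complex) \<Rightarrow> (real \<Rightarrow> complex) \<Rightarrow> real \<Rightarrow> real" where
  "rho A1 A2 t = (cmod (A1 t))\<^sup>2 + (cmod (A2 t))\<^sup>2"

definition DD :: "(real \<Rightarrow> complex) \<Rightarrow> (real \<Rightarrow> complex) \<Rightarrow> real \<Rightarrow> real" where
  "DD A1 A2 t = (cmod (A1 t))\<^sup>2 - (cmod (A2 t))\<^sup>2"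

definition RR :: "(real \<Rightarrow> complex) \<Rightarrow> (real \<Rightarrow> complex) \<Rightarrow> real \<Rightarrow> real" where
  "RR A1 A2 t = 2 * Re (cnj (A1 t) * A2 t)"

definition II :: "(real \<Rightarrow> complex) \<Rightarrow> (real \<Rightarrow> complex) \<Rightarrow> real \<Rightarrow> real" where
  "II A1 A2 t = 2 * Im (cnj (A1 t) * A2 t)"

end

theory Submission
  imports Defs
begin

text \<open>Put w = conj(A1) A2, so that R + i I = 2 w. The nonlinearities commute with a common
  phase rotation of (u1, u2), hence every product conj(A_j) F_k is a polynomial in |A1|^2, |A2|^2, w
  and conj(w), where |w|^2 = |A1|^2 |A2|^2. The derivatives of D, R, I are real or imaginary parts
  of such products, which is why the system closes in rho, D, R, I. For instance Im(conj(A1) F1) = I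
  (p1 D + (p2 - p3) R + p5 rho) / 2, and Im(conj(A2) F2) is its negative; together they give D'. The
  real potential rotates both components at the same rate, so the q's cancel. The product rule is
  \<open>DD_has_derivative\<close>, \<open>RR_has_derivative\<close>,
  \<open>II_has_derivative\<close>; the algebra is \<open>DD_identity\<close>,
  \<open>RR_identity\<close>, \<open>II_identity\<close>.\<close>

lemma vector_2_eq_scaleR_sum:
  "(vector [a, b] :: real ^ 2) = a *\<^sub>R vector [1, 0] + b *\<^sub>R vector [0, 1]"
  by (simp add: vec_eq_iff forall_2)

lemma has_vector_derivative_vector_2:
  assumes "(f has_real_derivative f') (at t within T)"
    and "(g has_real_derivative g') (at t within T)"
  shows "((\<lambda>s. vector [f s, g s] :: real ^ 2) has_vector_derivative vector [f', g']) (at t within T)"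
proof -
  have "((\<lambda>s. f s *\<^sub>R vector [1, 0] + g s *\<^sub>R vector [0, 1] :: real ^ 2) has_vector_derivative
      f' *\<^sub>R vector [1, 0] + g' *\<^sub>R vector [0, 1]) (at t within T)"
    by (rule derivative_eq_intros assms refl | simp)+
  then show ?thesis
    by (simp flip: vector_2_eq_scaleR_sum)
qed

text \<open>D, R and I are all real or imaginary parts of sesquilinear products conj(f) g, so a
  single product rule serves for the three. The equations of motion do not enter yet.\<close>

lemma
  assumes "(A1 has_vector_derivative d1) (at t within T)"
    and "(A2 has_vector_derivative d2) (at t within T)"
  shows DD_has_derivative:
      "(DD A1 A2 has_real_derivative 2 * Re (cnj (A1 t) * d1) - 2 * Re (cnj (A2 t) * d2))
        (at t within T)"
    and RR_has_derivative:
      "(RR A1 A2 has_real_derivative 2 * Re (cnj (A1 t) * d2 + cnj d1 * A2 t)) (at t within T)"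
    and II_has_derivative:
      "(II A1 A2 has_real_derivative 2 * Im (cnj (A1 t) * d2 + cnj d1 * A2 t)) (at t within T)"
proof -
  have prod: "((\<lambda>s. cnj (f s) * g s) has_vector_derivative cnj (f t) * g' + cnj f' * g t)
      (at t within T)"
    if "(f has_vector_derivative f') (at t within T)"
      "(g has_vector_derivative g') (at t within T)" for f g :: "real \<Rightarrow> complex" and f' g'
    using has_vector_derivative_mult[OF has_vector_derivative_cnj[OF that(1)] that(2)]
    by simp
  have Re: "((\<lambda>s. Re (h s)) has_real_derivative Re h') (at t within T)"
    and Im: "((\<lambda>s. Im (h s)) has_real_derivative Im h') (at t within T)"
    if "(h has_vector_derivative h') (at t within T)" for h h'
    using that by (auto simp: has_vector_derivative_complex_iff)
  \<comment> \<open>This brings D into the same sesquilinear form as R and I.\<close>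
  have cmod: "(cmod z)\<^sup>2 = Re (cnj z * z)" for z
    unfolding cmod_power2 by (simp add: power2_eq_square)
  show "(DD A1 A2 has_real_derivative 2 * Re (cnj (A1 t) * d1) - 2 * Re (cnj (A2 t) * d2))
        (at t within T)"
    using DERIV_diff[OF Re[OF prod[OF assms(1) assms(1)]] Re[OF prod[OF assms(2) assms(2)]]]
    by (simp add: DD_def[abs_def] cmod algebra_simps)
  show "(RR A1 A2 has_real_derivative 2 * Re (cnj (A1 t) * d2 + cnj d1 * A2 t)) (at t within T)"
    unfolding RR_def[abs_def] by (rule DERIV_cmult[OF Re[OF prod[OF assms]]])
  show "(II A1 A2 has_real_derivative 2 * Im (cnj (A1 t) * d2 + cnj d1 * A2 t)) (at t within T)"
    unfolding II_def[abs_def] by (rule DERIV_cmult[OF Im[OF prod[OF assms]]])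
qed

lemma Re_Im_of_ii_times_eq:
  assumes "\<i> * d = z"
  shows "Re d = Im z" "Im d = - Re z"
  using assms by auto

text \<open>Purely pointwise algebra: \<open>d1\<close> and \<open>d2\<close> are just complex
  numbers tied to the values \<open>A1 t\<close> and \<open>A2 t\<close> by the equations.\<close>

lemma
  fixes p1 p2 p3 p4 p5 q1 q2 q3 :: real and A1 A2 :: "real \<Rightarrow> complex"
  assumes "\<i> * d1 = F1 p1 p2 p3 p4 p5 q1 q2 q3 (A1 t) (A2 t)"
    and "\<i> * d2 = F2 p1 p2 p3 p4 p5 q1 q2 q3 (A1 t) (A2 t)"
  shows DD_identity:
      "2 * Re (cnj (A1 t) * d1) - 2 * Re (cnj (A2 t) * d2) =
        2 * II A1 A2 t * (p1 * DD A1 A2 t + (p2 - p3) * RR A1 A2 t)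
        + 2 * rho A1 A2 t * II A1 A2 t * p5"
    and RR_identity:
      "2 * Re (cnj (A1 t) * d2 + cnj d1 * A2 t) =
        2 * II A1 A2 t * ((- p2 - p3) * DD A1 A2 t + p1 * RR A1 A2 t)
        + 2 * rho A1 A2 t * II A1 A2 t * (- p4)"
    and II_identity:
      "2 * Im (cnj (A1 t) * d2 + cnj d1 * A2 t) =
        - 2 * p1 * ((DD A1 A2 t)\<^sup>2 + (RR A1 A2 t)\<^sup>2) + 4 * p3 * DD A1 A2 t * RR A1 A2 t
        + 2 * rho A1 A2 t * (- p5 * DD A1 A2 t + p4 * RR A1 A2 t)"
proof -
  \<comment> \<open>Once \<open>d1\<close> and \<open>d2\<close> are eliminated, each claim is an
    identity between quartic polynomials in the four real coordinates of \<open>A1 t\<close> and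
    \<open>A2 t\<close>, linear in the parameters. In these coordinates |w|^2 = |A1|^2 |A2|^2 holds
    automatically.\<close>
  note expand = Re_Im_of_ii_times_eq[OF assms(1)] Re_Im_of_ii_times_eq[OF assms(2)]
    F1_def F2_def pot_def rho_def DD_def RR_def II_def cmod_power2 Re_power2 Im_power2
  show "2 * Re (cnj (A1 t) * d1) - 2 * Re (cnj (A2 t) * d2) =
        2 * II A1 A2 t * (p1 * DD A1 A2 t + (p2 - p3) * RR A1 A2 t)
        + 2 * rho A1 A2 t * II A1 A2 t * p5"
    by (simp add: expand) algebra
  show "2 * Re (cnj (A1 t) * d2 + cnj d1 * A2 t) =
        2 * II A1 A2 t * ((- p2 - p3) * DD A1 A2 t + p1 * RR A1 A2 t)
        + 2 * rho A1 A2 t * II A1 A2 t * (- p4)"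
    by (simp add: expand) algebra
  show "2 * Im (cnj (A1 t) * d2 + cnj d1 * A2 t) =
        - 2 * p1 * ((DD A1 A2 t)\<^sup>2 + (RR A1 A2 t)\<^sup>2) + 4 * p3 * DD A1 A2 t * RR A1 A2 t
        + 2 * rho A1 A2 t * (- p5 * DD A1 A2 t + p4 * RR A1 A2 t)"
    by (simp add: expand) algebra
qed

theorem proposition5p1:
  fixes p1 p2 p3 p4 p5 q1 q2 q3 :: real
    and T :: "real set"
    and A1 A2 :: "real \<Rightarrow> complex"
  assumes "p1 \<ge> 0" and "p3 \<ge> 0" and "p5 \<ge> 0"
    and "\<not> (p1 = 0 \<and> p2 = 0 \<and> p3 = 0 \<and> p4 = 0 \<and> p5 = 0)"
    and "solves_system (F1 p1 p2 p3 p4 p5 q1 q2 q3) (F2 p1 p2 p3 p4 p5 q1 q2 q3) T A1 A2"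
  shows "\<forall>t\<in>T.
    ((\<lambda>s. vector [DD A1 A2 s, RR A1 A2 s] :: real ^ 2) has_vector_derivative
       ((2 * II A1 A2 t) *\<^sub>R
          ((vector [vector [p1, p2 - p3], vector [- p2 - p3, p1]] :: real ^ 2 ^ 2)
             *v vector [DD A1 A2 t, RR A1 A2 t])
        + (2 * rho A1 A2 t * II A1 A2 t) *\<^sub>R vector [p5, - p4]))
      (at t within T) \<and>
    (II A1 A2 has_real_derivative
       (- 2 * p1 * ((DD A1 A2 t)\<^sup>2 + (RR A1 A2 t)\<^sup>2) + 4 * p3 * DD A1 A2 t * RR A1 A2 t
        + 2 * rho A1 A2 t * (- p5 * DD A1 A2 t + p4 * RR A1 A2 t)))
      (at t within T)"
proof
  fix t assume "t \<in> T"
  then obtain d1 d2 where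
    d: "(A1 has_vector_derivative d1) (at t within T)"
      "(A2 has_vector_derivative d2) (at t within T)" and
    ode: "\<i> * d1 = F1 p1 p2 p3 p4 p5 q1 q2 q3 (A1 t) (A2 t)"
      "\<i> * d2 = F2 p1 p2 p3 p4 p5 q1 q2 q3 (A1 t) (A2 t)"
    using assms(5) unfolding solves_system_def by blast
  have rhs: "(2 * II A1 A2 t) *\<^sub>R
          ((vector [vector [p1, p2 - p3], vector [- p2 - p3, p1]] :: real ^ 2 ^ 2)
             *v vector [DD A1 A2 t, RR A1 A2 t])
        + (2 * rho A1 A2 t * II A1 A2 t) *\<^sub>R vector [p5, - p4] =
      (vector
        [2 * II A1 A2 t * (p1 * DD A1 A2 t + (p2 - p3) * RR A1 A2 t)
          + 2 * rho A1 A2 t * II A1 A2 t * p5,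
         2 * II A1 A2 t * ((- p2 - p3) * DD A1 A2 t + p1 * RR A1 A2 t)
          + 2 * rho A1 A2 t * II A1 A2 t * (- p4)] :: real ^ 2)"
    by (simp add: vec_eq_iff forall_2 matrix_vector_mult_def sum_2)
  show "((\<lambda>s. vector [DD A1 A2 s, RR A1 A2 s] :: real ^ 2) has_vector_derivative
       ((2 * II A1 A2 t) *\<^sub>R
          ((vector [vector [p1, p2 - p3], vector [- p2 - p3, p1]] :: real ^ 2 ^ 2)
             *v vector [DD A1 A2 t, RR A1 A2 t])
        + (2 * rho A1 A2 t * II A1 A2 t) *\<^sub>R vector [p5, - p4]))
      (at t within T) \<and>
    (II A1 A2 has_real_derivative
       (- 2 * p1 * ((DD A1 A2 t)\<^sup>2 + (RR A1 A2 t)\<^sup>2) + 4 * p3 * DD A1 A2 t * RR A1 A2 t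
        + 2 * rho A1 A2 t * (- p5 * DD A1 A2 t + p4 * RR A1 A2 t)))
      (at t within T)"
    \<comment> \<open>Read from right to left, the identities turn the claimed right-hand sides into
      the product-rule expressions. The functions and the time are given explicitly because the
      values in \<open>ode\<close> do not determine them.\<close>
    unfolding rhs
      DD_identity[where ?A1.0 = A1 and ?A2.0 = A2 and t = t, OF ode, symmetric]
      RR_identity[where ?A1.0 = A1 and ?A2.0 = A2 and t = t, OF ode, symmetric]
      II_identity[where ?A1.0 = A1 and ?A2.0 = A2 and t = t, OF ode, symmetric]
    by (intro conjI has_vector_derivative_vector_2 DD_has_derivative[OF d]
        RR_has_derivative[OF d] II_has_derivative[OF d])
qed

end
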